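(* Let $(Q,\mathcal{B})$ be a uniform nested SQS$(v)$ in which there are exactly $\frac{v}{2}\left(\frac{v}{2}-1\right)$ ND-pairs. Then $v \equiv 4 \pmod 6$ and the multiplicity of each ND-pair is $\frac{v-1}{3}$.
   Context: A Steiner quadruple system SQS$(v)$ is a pair $(Q,\mathcal{B})$ where $Q$ is a set of $v$ points and $\mathcal{B}$ is a collection of 4-subsets of $Q$ (blocks) such that every 3-subset of $Q$ is contained in exactly one block. (An SQS$(v)$ exists if and only if $v\ge 4$ and $v\equiv 2$ or $4 \pmod 6$.) A nested SQS$(v)$ is an SQS$(v)$ together with a partition of each block into two 2-subsets (pairs). A pair of points is an ND-pair if it is one of the two pairs in the partition of at least one block; the multiplicity of a pair is the number of blocks whose partition contains that pair. A nested SQS is uniform if all its ND-pairs have the same multiplicity. *)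

theory Defs
  imports Complex_Main "HOL-Library.Disjoint_Sets" "HOL-Number_Theory.Cong"
begin

(* The bound 4 \<le> v is the standing convention for Steiner quadruple systems; it excludes
   only the systems on v \<le> 2 points without blocks, in which the block conditions hold
   vacuously. *)
definition sqs :: "nat \<Rightarrow> 'a set \<Rightarrow> 'a set set \<Rightarrow> bool" where
  "sqs v Q \<B> \<longleftrightarrow>
     finite Q \<and> card Q = v \<and> 4 \<le> v \<and>
     (\<forall>B\<in>\<B>. B \<subseteq> Q \<and> card B = 4) \<and>
     (\<forall>T. T \<subseteq> Q \<and> card T = 3 \<longrightarrow> (\<exists>!B. B \<in> \<B> \<and> T \<subseteq> B))"

(* The nesting is the function P sending a block to its partition into two pairs; the values
   of P outside \<B> are irrelevant. *)
definition nested_sqs ::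
  "nat \<Rightarrow> 'a set \<Rightarrow> 'a set set \<Rightarrow> ('a set \<Rightarrow> 'a set set) \<Rightarrow> bool" where
  "nested_sqs v Q \<B> P \<longleftrightarrow>
     sqs v Q \<B> \<and>
     (\<forall>B\<in>\<B>. partition_on B (P B) \<and> card (P B) = 2 \<and> (\<forall>p\<in>P B. card p = 2))"

definition nd_pairs :: "'a set set \<Rightarrow> ('a set \<Rightarrow> 'a set set) \<Rightarrow> 'a set set" where
  "nd_pairs \<B> P = {p. \<exists>B\<in>\<B>. p \<in> P B}"

definition multiplicity_of_pair ::
  "'a set set \<Rightarrow> ('a set \<Rightarrow> 'a set set) \<Rightarrow> 'a set \<Rightarrow> nat" where
  "multiplicity_of_pair \<B> P p = card {B \<in> \<B>. p \<in> P B}"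

definition uniform_nested_sqs ::
  "nat \<Rightarrow> 'a set \<Rightarrow> 'a set set \<Rightarrow> ('a set \<Rightarrow> 'a set set) \<Rightarrow> bool" where
  "uniform_nested_sqs v Q \<B> P \<longleftrightarrow>
     nested_sqs v Q \<B> P \<and>
     (\<forall>p\<in>nd_pairs \<B> P. \<forall>q\<in>nd_pairs \<B> P.
        multiplicity_of_pair \<B> P p = multiplicity_of_pair \<B> P q)"

end

theory Submission
  imports Defs
begin

text \<open>
  Double counting. Each of the \<open>v choose 3\<close> triples lies in one block and each block contains four
  triples, so there are \<open>v (v - 1) (v - 2) / 24\<close> blocks. Every block contributes two pairs to its
  partition, so the multiplicities sum to \<open>v (v - 1) (v - 2) / 12\<close>. If \<open>v (v - 2) / 4\<close> pairs share this
  total equally, each has multiplicity \<open>(v - 1) / 3\<close>. Hence \<open>v\<close> is 1 modulo 3, and since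
  \<open>v (v - 2)\<close> is a multiple of 4, \<open>v\<close> is even.
\<close>

text \<open>Absorption is applied twice; the factor 6 avoids division. Truncated subtraction is
  harmless, since both sides vanish for \<open>n < 3\<close>.\<close>

lemma six_times_choose_three: "6 * (n choose 3) = n * (n - 1) * (n - 2)"
proof -
  have "3 * (n choose 3) = n * ((n - 1) choose 2)"
    using binomial_absorption[of 2 n] by (simp add: eval_nat_numeral)
  moreover have "2 * ((n - 1) choose 2) = (n - 1) * (n - 2)"
    using binomial_absorption[of 1 "n - 1"] by (simp add: eval_nat_numeral)
  moreover have "6 * (n choose 3) = 2 * (3 * (n choose 3))" by simp
  ultimately show ?thesis by (simp only: mult_ac)
qed

lemma sqs_finite_blocks:
  assumes "sqs v Q \<B>"
  shows "finite \<B>"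
proof (rule finite_subset)
  show "\<B> \<subseteq> Pow Q" using assms unfolding sqs_def by auto
  show "finite (Pow Q)" using assms unfolding sqs_def by simp
qed

lemma sqs_card_blocks:
  assumes "sqs v Q \<B>"
  shows "24 * card \<B> = v * (v - 1) * (v - 2)"
proof -
  have Q: "finite Q" "card Q = v"
    and blk: "\<And>B. B \<in> \<B> \<Longrightarrow> B \<subseteq> Q \<and> card B = 4"
    and ex1: "\<And>T. T \<subseteq> Q \<Longrightarrow> card T = 3 \<Longrightarrow> \<exists>!B. B \<in> \<B> \<and> T \<subseteq> B"
    using assms unfolding sqs_def by auto
  have finB: "finite B" if "B \<in> \<B>" for B
    using blk[OF that] Q(1) finite_subset by blast
  let ?triples = "\<lambda>B. {T. T \<subseteq> B \<and> card T = 3}"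
  have "v choose 3 = card (?triples Q)"
    using n_subsets[OF Q(1), of 3] Q(2) by simp
  \<comment> \<open>Existence of a block through each triple gives the covering; uniqueness makes
    the union disjoint, so cardinalities add.\<close>
  also have "?triples Q = (\<Union>B\<in>\<B>. ?triples B)"
  proof (intro subset_antisym subsetI)
    fix T assume "T \<in> ?triples Q"
    then obtain B where "B \<in> \<B>" "T \<subseteq> B" using ex1[of T] by auto
    then show "T \<in> (\<Union>B\<in>\<B>. ?triples B)" using \<open>T \<in> ?triples Q\<close> by auto
  next
    fix T assume "T \<in> (\<Union>B\<in>\<B>. ?triples B)"
    then show "T \<in> ?triples Q" using blk by fast
  qed
  also have "card \<dots> = (\<Sum>B\<in>\<B>. card (?triples B))"
  proof (rule card_UN_disjoint)
    show "\<forall>B\<in>\<B>. \<forall>C\<in>\<B>. B \<noteq> C \<longrightarrow> ?triples B \<inter> ?triples C = {}"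
    proof (intro ballI impI equals0I)
      fix B C T assume "B \<in> \<B>" "C \<in> \<B>" "B \<noteq> C" "T \<in> ?triples B \<inter> ?triples C"
      moreover from this have "T \<subseteq> Q" using blk by blast
      ultimately show False using ex1[of T] by auto
    qed
  qed (use sqs_finite_blocks[OF assms] finB in auto)
  \<comment> \<open>The summand is \<open>4 choose 3\<close>.\<close>
  also have "\<dots> = (\<Sum>B\<in>\<B>. 4)"
    using blk finB by (intro sum.cong refl) (simp add: n_subsets eval_nat_numeral)
  finally have "v choose 3 = 4 * card \<B>" by simp
  then show ?thesis using six_times_choose_three[of v] by simp
qed

lemma nested_sqs_sum_multiplicity:
  assumes "nested_sqs v Q \<B> P"
  shows "(\<Sum>p\<in>nd_pairs \<B> P. multiplicity_of_pair \<B> P p) = 2 * card \<B>"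
proof -
  have cardP: "\<And>B. B \<in> \<B> \<Longrightarrow> card (P B) = 2" and fin: "finite \<B>"
    using assms sqs_finite_blocks unfolding nested_sqs_def by blast+
  have nd: "nd_pairs \<B> P = (\<Union>B\<in>\<B>. P B)"
    unfolding nd_pairs_def by auto
  \<comment> \<open>Each \<open>P B\<close> is finite because its cardinality is nonzero.\<close>
  have finN: "finite (nd_pairs \<B> P)"
    unfolding nd using fin cardP by (auto intro!: finite_UN_I card_ge_0_finite)
  \<comment> \<open>Incidences \<open>p \<in> P B\<close> are counted block by block instead of pair
    by pair.\<close>
  have "(\<Sum>p\<in>nd_pairs \<B> P. multiplicity_of_pair \<B> P p) = (\<Sum>B\<in>\<B>. card {p \<in> nd_pairs \<B> P. p \<in> P B})"
    unfolding multiplicity_of_pair_def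
    using sum.swap_restrict[OF finN fin, of "\<lambda>_ _. 1::nat" "\<lambda>p B. p \<in> P B"] by simp
  also have "\<dots> = (\<Sum>B\<in>\<B>. 2)"
  proof (rule sum.cong[OF refl])
    fix B assume "B \<in> \<B>"
    then have "{p \<in> nd_pairs \<B> P. p \<in> P B} = P B" unfolding nd by auto
    then show "card {p \<in> nd_pairs \<B> P. p \<in> P B} = 2" using cardP \<open>B \<in> \<B>\<close> by simp
  qed
  finally show ?thesis by simp
qed

theorem theorem4p3:
  fixes v :: nat and Q :: "'a set" and \<B> :: "'a set set" and P :: "'a set \<Rightarrow> 'a set set"
  assumes "uniform_nested_sqs v Q \<B> P"
    and "real (card (nd_pairs \<B> P)) = real v / 2 * (real v / 2 - 1)"
  shows "[v = 4] (mod 6) \<and>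
    (\<forall>p\<in>nd_pairs \<B> P. real (multiplicity_of_pair \<B> P p) = (real v - 1) / 3)"
proof -
  let ?N = "card (nd_pairs \<B> P)"
  have nested: "nested_sqs v Q \<B> P"
    and unif: "\<And>p q. p \<in> nd_pairs \<B> P \<Longrightarrow> q \<in> nd_pairs \<B> P \<Longrightarrow>
      multiplicity_of_pair \<B> P p = multiplicity_of_pair \<B> P q"
    using assms(1) unfolding uniform_nested_sqs_def by blast+
  have sqs: "sqs v Q \<B>" using nested unfolding nested_sqs_def by blast
  then have v4: "4 \<le> v" unfolding sqs_def by blast
  have "real (4 * ?N) = real (v * (v - 2))"
    using assms(2) v4 by (simp add: of_nat_diff field_simps)
  then have N: "4 * ?N = v * (v - 2)" by linarith
  \<comment> \<open>Positivity serves twice: to cancel \<open>?N\<close> and to supply an ND-pair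
    from which divisibility by 3 is read off.\<close>
  have Npos: "?N > 0" using N v4 by (intro gr0I) simp
  have mult: "3 * multiplicity_of_pair \<B> P p = v - 1" if "p \<in> nd_pairs \<B> P" for p
  proof -
    have "(\<Sum>q\<in>nd_pairs \<B> P. multiplicity_of_pair \<B> P q) = ?N * multiplicity_of_pair \<B> P p"
      using unif[OF _ that] by simp
    \<comment> \<open>The sum is \<open>2 * card \<B>\<close>, so 12 times it is
      \<open>24 * card \<B>\<close>. The factor \<open>v * (v - 2)\<close> stands first so that it
      can be replaced by \<open>4 * ?N\<close> and cancelled.\<close>
    then have "12 * (?N * multiplicity_of_pair \<B> P p) = v * (v - 2) * (v - 1)"
      using nested_sqs_sum_multiplicity[OF nested] sqs_card_blocks[OF sqs] by (simp add: mult_ac)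
    then have "4 * ?N * (3 * multiplicity_of_pair \<B> P p) = 4 * ?N * (v - 1)"
      unfolding N[symmetric] by simp
    then show ?thesis using Npos by simp
  qed
  obtain p where "p \<in> nd_pairs \<B> P" using Npos by fastforce
  then have "3 dvd v - 1" using mult dvd_triv_left by metis
  moreover have "even v"
  proof -
    \<comment> \<open>The product equals \<open>4 * ?N\<close>, and its two factors have the same
      parity.\<close>
    have "even (v * (v - 2))" unfolding N[symmetric] by simp
    then show ?thesis using v4 by simp
  qed
  ultimately have "v mod 6 = 4" using v4 by presburger
  moreover have "real (multiplicity_of_pair \<B> P p) = (real v - 1) / 3" if "p \<in> nd_pairs \<B> P" for p
  proof -
    have "v = 3 * multiplicity_of_pair \<B> P p + 1" using mult[OF that] v4 by linarith
    then show ?thesis by simp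
  qed
  ultimately show ?thesis by (simp add: cong_def)
qed

end
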